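(* Let $V$ be a vacuum-free vertex algebra and let $W$ be a vector space equipped with a linear map $Y_W(\cdot,x):V\to(\mathrm{End}\,W)[[x,x^{-1}]]$, $v\mapsto Y_W(v,x)=\sum_{n\in\mathbb Z}v_nx^{-n-1}$, such that $Y_W(u,x)w\in W((x))$ for all $u\in V$, $w\in W$. Then weak skew-associativity together with vacuum-free skew-symmetry can replace the Jacobi identity in the definition of module for a vacuum-free vertex algebra; that is, the Jacobi identity $$x_0^{-1}\delta\left(\frac{x_1-x_2}{x_0}\right)Y_W(u,x_1)Y_W(v,x_2)w-x_0^{-1}\delta\left(\frac{-x_2+x_1}{x_0}\right)Y_W(v,x_2)Y_W(u,x_1)w=x_1^{-1}\delta\left(\frac{x_2+x_0}{x_1}\right)Y_W(Y(u,x_0)v,x_2)w$$ holds for all $u,v\in V$, $w\in W$ if and only if both of the following hold: (weak skew-associativity) for all $u,v\in V$, $w\in W$ there exists an integer $m\ge0$ such that $(x_1-x_0)^{m}\left(Y_W(v,-x_0+x_1)Y_W(u,x_1)w-Y_W(Y(u,x_0)v,x_1-x_0)w\right)=0$; (vacuum-free skew-symmetry) for all $u,v\in V$, $Y_W(Y(u,x_0)v,x_2)=Y_W(Y(v,-x_0)u,x_2+x_0)$.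
   Context: All vector spaces are over $\mathbb C$; formal variables commute. For a vector space $U$, $U[[x,x^{-1}]]$ is the space of all formal Laurent series $\sum_{n\in\mathbb Z}u_nx^n$ with $u_n\in U$; $U((x))$ is the subspace of series with $u_n=0$ for $n$ sufficiently negative. $\delta(x)=\sum_{n\in\mathbb Z}x^n$. Binomial expansion convention: for every $n\in\mathbb Z$, $(x+y)^n=\sum_{k\ge0}\binom nk x^{n-k}y^k$, i.e. binomials are expanded in nonnegative powers of the second-listed variable (likewise with signs, so $(x_1-x_2)^n$ is expanded in nonnegative powers of $x_2$ and $(-x_2+x_1)^n$ in nonnegative powers of $x_1$); this applies inside $\delta$ and to substitutions such as $F(x+y)$. Vertex operator maps are extended coefficientwise to series: $Y_W(Y(u,x_0)v,x_2)=\sum_n Y_W(u_nv,x_2)x_0^{-n-1}$. A vacuum-free vertex algebra is a vector space $V$ with an injective linear map $Y(\cdot,x):V\to(\mathrm{End}\,V)[[x,x^{-1}]]$, $v\mapsto Y(v,x)=\sum_{n\in\mathbb Z}v_nx^{-n-1}$, such that $Y(u,x)v\in V((x))$ for all $u,v\in V$ and the Jacobi identity holds for all $u,v\in V$: $$x_0^{-1}\delta\left(\tfrac{x_1-x_2}{x_0}\right)Y(u,x_1)Y(v,x_2)-x_0^{-1}\delta\left(\tfrac{-x_2+x_1}{x_0}\right)Y(v,x_2)Y(u,x_1)=x_1^{-1}\delta\left(\tfrac{x_2+x_0}{x_1}\right)Y(Y(u,x_0)v,x_2).$$ A module for a vacuum-free vertex algebra $V$ is a vector space $W$ with a linear map $Y_W(\cdot,x):V\to(\mathrm{End}\,W)[[x,x^{-1}]]$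 such that $Y_W(u,x)w\in W((x))$ for all $u\in V$, $w\in W$ and the module Jacobi identity (displayed in the claim) holds. *)

theory Defs
  imports Complex_Main "HOL-Library.Groups_Big_Fun"
begin

text \<open>
  A formal series in several commuting variables is the function sending a tuple of integer
  exponents to its coefficient. In particular an element of (End W)[[x,x^-1]] is a family
  \<open>f :: int \<Rightarrow> 'w \<Rightarrow> 'w\<close> of linear maps, \<open>f k\<close> being the coefficient of x^k. A vertex operator
  map is indexed by exponents rather than by modes: for Y(v,x) = sum_n v_n x^(-n-1) the
  term \<open>Y v k\<close> is the coefficient of x^k, that is, the mode v_(-k-1). So Y(u,x)v is
  \<open>\<lambda>k. Y u k v\<close>, and Y_W(Y(u,x0)v,x2)w, in the exponents of x0 and x2, is
  \<open>\<lambda>a c. YW (Y u a v) c w\<close>.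

  Coefficients of products and substitutions are formed with \<open>Sum_any\<close>, the sum of a finitely
  supported family. In all the series below the families are finitely supported because of the
  truncation condition.
\<close>

definition lower_truncated :: "(int \<Rightarrow> 'a::zero) \<Rightarrow> bool" where
  "lower_truncated f \<longleftrightarrow> (\<exists>N. \<forall>k<N. f k = 0)"

text \<open>Coefficient of x^i y^j in (\<open>\<alpha>\<close> x + \<open>\<beta>\<close> y)^n, expanded in nonnegative powers of y;
  only used for signs \<open>\<alpha>\<close>, \<open>\<beta>\<close>.\<close>
definition binom_expansion ::
    "complex \<Rightarrow> complex \<Rightarrow> int \<Rightarrow> int \<Rightarrow> int \<Rightarrow> complex" where
  "binom_expansion \<alpha> \<beta> n i j =
     (if 0 \<le> j \<and> i = n - j
      then ((of_int n :: complex) gchoose nat j) * \<alpha> powi i * \<beta> powi j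
      else 0)"

definition formal_delta :: "int \<Rightarrow> complex" where
  "formal_delta n = 1"

text \<open>Coefficient of x^i y^j z^k in
  z^-1 delta((\<open>\<alpha>\<close> x + \<open>\<beta>\<close> y)/z) = sum_n delta_n (\<open>\<alpha>\<close> x + \<open>\<beta>\<close> y)^n z^(-n-1):
  only n = -k-1 contributes.\<close>
definition delta_quotient ::
    "complex \<Rightarrow> complex \<Rightarrow> int \<Rightarrow> int \<Rightarrow> int \<Rightarrow> complex" where
  "delta_quotient \<alpha> \<beta> i j k = formal_delta (- k - 1) * binom_expansion \<alpha> \<beta> (- k - 1) i j"

definition series_mult2 ::
    "(complex \<Rightarrow> 'w \<Rightarrow> 'w) \<Rightarrow> (int \<Rightarrow> int \<Rightarrow> complex) \<Rightarrow> (int \<Rightarrow> int \<Rightarrow> 'w)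
     \<Rightarrow> int \<Rightarrow> int \<Rightarrow> 'w::ab_group_add" where
  "series_mult2 scale P F a b = Sum_any (\<lambda>(i, j). scale (P i j) (F (a - i) (b - j)))"

definition series_mult3 ::
    "(complex \<Rightarrow> 'w \<Rightarrow> 'w) \<Rightarrow> (int \<Rightarrow> int \<Rightarrow> int \<Rightarrow> complex) \<Rightarrow> (int \<Rightarrow> int \<Rightarrow> int \<Rightarrow> 'w)
     \<Rightarrow> int \<Rightarrow> int \<Rightarrow> int \<Rightarrow> 'w::ab_group_add" where
  "series_mult3 scale P F a b c =
     Sum_any (\<lambda>(i, j, k). scale (P i j k) (F (a - i) (b - j) (c - k)))"

text \<open>For F(z,y) = sum F_{n,q} z^n y^q, the coefficient of x^i y^j in F(\<open>\<alpha>\<close> x + \<open>\<beta>\<close> y, y), the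
  powers of \<open>\<alpha>\<close> x + \<open>\<beta>\<close> y being expanded in nonnegative powers of y.\<close>
definition series_subst ::
    "(complex \<Rightarrow> 'w \<Rightarrow> 'w) \<Rightarrow> complex \<Rightarrow> complex \<Rightarrow> (int \<Rightarrow> int \<Rightarrow> 'w)
     \<Rightarrow> int \<Rightarrow> int \<Rightarrow> 'w::ab_group_add" where
  "series_subst scale \<alpha> \<beta> F i j =
     Sum_any (\<lambda>(n, q). scale (binom_expansion \<alpha> \<beta> n i (j - q)) (F n q))"

text \<open>The arguments \<open>a\<close>, \<open>b\<close>, \<open>c\<close> are the exponents of x0, x1, x2. A series that does not
  involve one of the variables is supported at exponent 0 of that variable.\<close>
definition jacobi_identity ::
    "(complex \<Rightarrow> 'w \<Rightarrow> 'w) \<Rightarrow> ('v \<Rightarrow> int \<Rightarrow> 'v \<Rightarrow> 'v) \<Rightarrow> ('v \<Rightarrow> int \<Rightarrow> 'w \<Rightarrow> 'w)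
     \<Rightarrow> 'v \<Rightarrow> 'v \<Rightarrow> 'w::ab_group_add \<Rightarrow> bool" where
  "jacobi_identity scale Y YW u v w \<longleftrightarrow>
     (\<forall>a b c.
        series_mult3 scale (\<lambda>a b c. delta_quotient 1 (-1) b c a)
          (\<lambda>a b c. if a = 0 then YW u b (YW v c w) else 0) a b c
        - series_mult3 scale (\<lambda>a b c. delta_quotient (-1) 1 c b a)
          (\<lambda>a b c. if a = 0 then YW v c (YW u b w) else 0) a b c
        = series_mult3 scale (\<lambda>a b c. delta_quotient 1 1 c a b)
          (\<lambda>a b c. if b = 0 then YW (Y u a v) c w else 0) a b c)"

text \<open>Here \<open>a\<close>, \<open>b\<close> are the exponents of x0, x1. The two substitutions are z = -x0 + x1 in
  Y_W(v,z)Y_W(u,x1)w and z = x1 - x0 in Y_W(Y(u,x0)v,z)w.\<close>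
definition weak_skew_associativity ::
    "(complex \<Rightarrow> 'w \<Rightarrow> 'w) \<Rightarrow> ('v \<Rightarrow> int \<Rightarrow> 'v \<Rightarrow> 'v) \<Rightarrow> ('v \<Rightarrow> int \<Rightarrow> 'w \<Rightarrow> 'w)
     \<Rightarrow> 'v \<Rightarrow> 'v \<Rightarrow> 'w::ab_group_add \<Rightarrow> bool" where
  "weak_skew_associativity scale Y YW u v w \<longleftrightarrow>
     (\<exists>m::nat. \<forall>a b.
        series_mult2 scale (\<lambda>a b. binom_expansion 1 (-1) (int m) b a)
          (\<lambda>a b. series_subst scale (-1) 1 (\<lambda>n q. YW v n (YW u q w)) a b
               - series_subst scale 1 (-1) (\<lambda>n q. YW (Y u q v) n w) b a) a b
        = 0)"

text \<open>Equality of operators, tested on all vectors; \<open>a\<close>, \<open>c\<close> are the exponents of x0, x2.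
  The sign \<open>(-1) powi q\<close> comes from the coefficient of x0^q in Y(v,-x0)u.\<close>
definition vacuum_free_skew_symmetry ::
    "(complex \<Rightarrow> 'v \<Rightarrow> 'v) \<Rightarrow> (complex \<Rightarrow> 'w \<Rightarrow> 'w) \<Rightarrow> ('v \<Rightarrow> int \<Rightarrow> 'v \<Rightarrow> 'v)
     \<Rightarrow> ('v \<Rightarrow> int \<Rightarrow> 'w \<Rightarrow> 'w::ab_group_add) \<Rightarrow> 'v \<Rightarrow> 'v \<Rightarrow> bool" where
  "vacuum_free_skew_symmetry scaleV scaleW Y YW u v \<longleftrightarrow>
     (\<forall>w a c.
        YW (Y u a v) c w
        = series_subst scaleW 1 1 (\<lambda>n q. YW (scaleV ((-1) powi q) (Y v q u)) n w) c a)"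

text \<open>Linearity of V \<open>\<rightarrow>\<close> (End W)[[x,x^-1]] is linearity of each coefficient.
  \<open>Vector_Spaces.linear\<close> includes that both spaces are vector spaces.\<close>
locale vertex_operator_map =
  fixes scaleV :: "complex \<Rightarrow> 'v::ab_group_add \<Rightarrow> 'v"
    and scaleW :: "complex \<Rightarrow> 'w::ab_group_add \<Rightarrow> 'w"
    and YW :: "'v \<Rightarrow> int \<Rightarrow> 'w \<Rightarrow> 'w"
  assumes linear_operator: "Vector_Spaces.linear scaleW scaleW (YW v k)"
    and linear_map: "Vector_Spaces.linear scaleV scaleW (\<lambda>v. YW v k w)"
    and truncation: "lower_truncated (\<lambda>k. YW u k w)"

locale vacuum_free_vertex_algebra = vertex_operator_map scaleV scaleV Y
  for scaleV :: "complex \<Rightarrow> 'v::ab_group_add \<Rightarrow> 'v"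
    and Y :: "'v \<Rightarrow> int \<Rightarrow> 'v \<Rightarrow> 'v" +
  assumes injective: "inj Y"
    and jacobi: "jacobi_identity scaleV Y Y u v w"

end

theory Submission
  imports Defs
begin

text \<open>
  Each of the three terms of the Jacobi identity, for fixed \<open>u\<close>, \<open>v\<close>, \<open>w\<close>, is a delta series times
  a series in two variables, and is therefore a solution \<open>E(x0,x1,x2)\<close> of the equation
  x0 E = (x1 - x2) E (\<open>delta_equation\<close>). Everything rests on how rigid this equation is. It
  expresses the coefficients of E in lower powers of x1 by those in a given power of x1, and the
  same holds for x2. Hence a solution is determined in all exponents b \<open>\<le>\<close> -1 of x1 by its residue
  in x1, and in all exponents c \<open>\<le>\<close> -1 of x2 by its residue in x2
  (\<open>delta_equation_eq_below\<close>). A solution that vanishes for all sufficiently low powers of x1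
  and for all sufficiently low powers of x2 vanishes identically
  (\<open>delta_equation_quadrant_zero\<close>).

  Write L, R and K for the terms with Y_W(u,x1)Y_W(v,x2)w, with Y_W(v,x2)Y_W(u,x1)w and with the
  iterate, so that the Jacobi identity is L - R = K. Both axioms to be compared with it are
  statements about residues, and by rigidity they become statements about the three-variable
  series.

  The two sides of weak skew-associativity are the residues in x2 of -R and of K. On solutions
  of the delta equation, multiplication by x1 - x0 is multiplication by x2, so annihilation of the
  residue of -R - K by a power of x1 - x0 means exactly that R + K vanishes in low powers of x2
  (\<open>weak_skew_associativity_iff\<close>). Under the Jacobi identity R + K is L, which is bounded below in
  x2 because Y_W(v,x2)w is.

  Exchanging u with v, x1 with x2 and x0 with -x0 exchanges L with -R. Skew-symmetry says that the
  residues of K in x1 agree with those of the exchanged series, hence that K is invariant under the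
  exchange in negative powers of x1 (\<open>vacuum_free_skew_symmetry_iff\<close>). Under the Jacobi identity
  for both orders, K = L - R is invariant without restriction.

  Conversely, weak skew-associativity for u, v makes L - R - K vanish in low powers of x2, as both
  L and R + K do. Weak skew-associativity for v, u, transported by skew-symmetry, makes L - K
  vanish in low powers of x1, where R vanishes as well. So L - R - K = 0. This
  argument lets the exponent m of weak skew-associativity depend on all of u, v and w.
\<close>

section \<open>Series annihilated by x0 - x1 + x2\<close>

text \<open>The arguments are the exponents of x0, x1, x2; the equation is x0 E = (x1 - x2) E.\<close>
definition delta_equation :: "(int \<Rightarrow> int \<Rightarrow> int \<Rightarrow> 'w::ab_group_add) \<Rightarrow> bool" where
  "delta_equation E \<longleftrightarrow> (\<forall>a b c. E (a - 1) b c = E a (b - 1) c - E a b (c - 1))"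

text \<open>Read as x1 E = (x0 + x2) E, the delta equation computes the coefficients at exponent b - 1 of
  x1 from those at exponent b.\<close>
lemma delta_equation_eq_below:
  assumes E: "delta_equation E" and F: "delta_equation F"
    and plane: "\<And>a c. E a k c = F a k c" and "b \<le> k"
  shows "E a b c = F a b c"
  using \<open>b \<le> k\<close>
proof (induction b arbitrary: a c rule: int_le_induct)
  case base
  show ?case by (rule plane)
next
  case (step b)
  have "E a (b - 1) c = E (a - 1) b c + E a b (c - 1)"
    using E by (simp add: delta_equation_def)
  also have "\<dots> = F (a - 1) b c + F a b (c - 1)"
    by (simp add: step)
  also have "\<dots> = F a (b - 1) c"
    using F by (simp add: delta_equation_def)
  finally show ?case .
qed

lemma delta_equation_zero: "delta_equation (\<lambda>a b c. 0)"
  by (simp add: delta_equation_def)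

lemma delta_equation_diff:
  "delta_equation E \<Longrightarrow> delta_equation F \<Longrightarrow> delta_equation (\<lambda>a b c. E a b c - F a b c)"
  by (simp add: delta_equation_def)

lemma delta_equation_minus:
  "delta_equation E \<Longrightarrow> delta_equation (\<lambda>a b c. - E a b c)"
  by (simp add: delta_equation_def)

text \<open>Applied at exponent a + 1 of x0, the delta equation reduces a coefficient with exponents b, c
  of x1, x2 to two coefficients with a smaller sum b + c, at the price of raising the exponent of
  x0; as the vanishing is required for all exponents of x0, this price does not matter.\<close>
lemma delta_equation_quadrant_zero:
  assumes E: "delta_equation E"
    and b: "\<And>a b c. b \<le> b0 \<Longrightarrow> E a b c = 0" and c: "\<And>a b c. c \<le> c0 \<Longrightarrow> E a b c = 0"
  shows "E a b c = 0"
proof (induction "nat (b - b0) + nat (c - c0)" arbitrary: a b c rule: less_induct)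
  case less
  show ?case
  proof (cases "b \<le> b0 \<or> c \<le> c0")
    case True
    then show ?thesis using b c by blast
  next
    case False
    have "E a b c = E (a + 1) (b - 1) c - E (a + 1) b (c - 1)"
      using E unfolding delta_equation_def by (metis add_diff_cancel_right')
    also have "\<dots> = 0"
      using False by (simp add: less)
    finally show ?thesis .
  qed
qed

locale complex_space = vector_space scale
  for scale :: "complex \<Rightarrow> 'w::ab_group_add \<Rightarrow> 'w"
begin

text \<open>The equation is invariant under exchanging x1 with x2 and x0 with -x0. This is the
  symmetry behind skew-symmetry, and it turns each fact about low powers of x1 into one about low
  powers of x2.\<close>
lemma delta_equation_swap:
  assumes "delta_equation E"
  shows "delta_equation (\<lambda>a b c. scale ((-1) powi a) (E a c b))"
  unfolding delta_equation_def
proof (intro allI)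
  fix a b c
  have "E (a - 1) c b = E a (c - 1) b - E a c (b - 1)"
    using assms by (simp only: delta_equation_def)
  moreover have "(-1) powi (a - 1) = (- ((-1) powi a) :: complex)"
    by (simp add: power_int_diff)
  ultimately show "scale ((-1) powi (a - 1)) (E (a - 1) c b) =
      scale ((-1) powi a) (E a c (b - 1)) - scale ((-1) powi a) (E a (c - 1) b)"
    by (simp only: scale_minus_left scale_right_diff_distrib) simp
qed

lemma delta_equation_zero_below:
  fixes E :: "int \<Rightarrow> int \<Rightarrow> int \<Rightarrow> 'w"
  assumes E: "delta_equation E" and "\<And>a b. E a b k = 0" and "c \<le> k"
  shows "E a b c = 0"
proof -
  have "scale ((-1) powi a) (E a b c) = 0"
    by (rule delta_equation_eq_below[OF delta_equation_swap[OF E] delta_equation_zero, where k = k])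
       (simp_all add: assms(2,3))
  then show ?thesis by simp
qed

lemma delta_equation_vanishes_below_iff:
  fixes E :: "int \<Rightarrow> int \<Rightarrow> int \<Rightarrow> 'w"
  assumes "delta_equation E"
  shows "(\<exists>m. \<forall>a b. E a b (-1 - int m) = 0) \<longleftrightarrow> (\<exists>N. \<forall>a b c. c < N \<longrightarrow> E a b c = 0)"
proof
  assume "\<exists>m. \<forall>a b. E a b (-1 - int m) = 0"
  then obtain m where "\<And>a b. E a b (-1 - int m) = 0" by blast
  then have "E a b c = 0" if "c < - int m" for a b c
    by (rule delta_equation_zero_below[OF assms]) (use that in linarith)
  then show "\<exists>N. \<forall>a b c. c < N \<longrightarrow> E a b c = 0" by blast
next
  assume "\<exists>N. \<forall>a b c. c < N \<longrightarrow> E a b c = 0"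
  then obtain N where N: "\<And>a b c. c < N \<Longrightarrow> E a b c = 0" by blast
  have "-1 - int (nat (- N)) < N" by linarith
  then have "\<forall>a b. E a b (-1 - int (nat (- N))) = 0"
    by (intro allI) (rule N)
  then show "\<exists>m. \<forall>a b. E a b (-1 - int m) = 0" ..
qed

end

section \<open>Products of a delta series with a series in two variables\<close>

text \<open>Coefficient of \<open>y^p z^q t^r\<close> in \<open>y^-1 delta((t + s z)/y) X(z,t)\<close>, for variables y, z, t that will be
  x0, x1, x2 in various orders. All three terms of the Jacobi identity, all substitutions
  F(\<open>\<alpha>\<close> x + \<open>\<beta>\<close> y, y), and multiplication by a power of x1 - x0 are values of this one function.\<close>
definition delta_product ::
    "(complex \<Rightarrow> 'w \<Rightarrow> 'w) \<Rightarrow> complex \<Rightarrow> (int \<Rightarrow> int \<Rightarrow> 'w) \<Rightarrow> int \<Rightarrow> int \<Rightarrow> int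
     \<Rightarrow> 'w::ab_group_add" where
  "delta_product scale s X p q r =
     Sum_any (\<lambda>k::nat. scale ((of_int (- p - 1) gchoose k) * s ^ k)
                          (X (q - int k) (r + p + 1 + int k)))"

text \<open>The inverse is demanded on the support of \<open>g\<close> only: there the binomial factors pin down
  all exponents but one.\<close>
lemma Sum_any_reindex_inj:
  assumes "inj f" and "\<And>x. g x \<noteq> 0 \<Longrightarrow> x = f (h x)"
  shows "Sum_any g = Sum_any (\<lambda>k. g (f k))"
proof -
  have supp: "{x. g x \<noteq> 0} = f ` {k. g (f k) \<noteq> 0}"
    using assms(2) by force
  show ?thesis
    unfolding Sum_any.expand_set supp
    by (subst sum.reindex) (auto intro: inj_on_subset[OF assms(1)])
qed

lemma gchoose_of_int_eq_0:
  "0 \<le> n \<Longrightarrow> nat n < k \<Longrightarrow> ((of_int n :: complex) gchoose k) = 0"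
  by (metis binomial_eq_0 binomial_gbinomial of_int_of_nat_eq of_nat_0 nonneg_int_cases nat_int)

context complex_space
begin

text \<open>This holds for infinite supports too, as both sides are then zero; so scalars and signs
  can be moved through the sums before finiteness is known.\<close>
lemma Sum_any_scale:
  assumes "c \<noteq> 0"
  shows "Sum_any (\<lambda>k. scale c (f k)) = scale c (Sum_any f)"
  using assms by (simp add: Sum_any.expand_set scale_sum_right)

lemma delta_product_eq_sum:
  assumes "\<And>k. M \<le> k \<Longrightarrow>
    (of_int (- p - 1) :: complex) gchoose k = 0 \<or> X (q - int k) (r + p + 1 + int k) = 0"
  shows "delta_product scale s X p q r =
    (\<Sum>k<M. scale ((of_int (- p - 1) gchoose k) * s ^ k) (X (q - int k) (r + p + 1 + int k)))"
  unfolding delta_product_def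
proof (rule Sum_any.expand_superset)
  show "{k. scale ((of_int (- p - 1) gchoose k) * s ^ k) (X (q - int k) (r + p + 1 + int k)) \<noteq> 0}
      \<subseteq> {..<M}"
  proof
    fix k
    assume "k \<in> {k. scale ((of_int (- p - 1) gchoose k) * s ^ k)
        (X (q - int k) (r + p + 1 + int k)) \<noteq> 0}"
    then show "k \<in> {..<M}"
      using assms[of k] by (cases "k < M") (auto simp del: of_int_diff of_int_minus)
  qed
qed simp

lemma Pascal_sum:
  "(\<Sum>k<Suc M. scale ((n + 1 gchoose k) * s ^ k) (G k)) =
   (\<Sum>k<Suc M. scale ((n gchoose k) * s ^ k) (G k))
   + scale s (\<Sum>k<M. scale ((n gchoose k) * s ^ k) (G (Suc k)))"
proof -
  have "scale ((n + 1 gchoose Suc k) * s ^ Suc k) (G (Suc k)) =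
      scale ((n gchoose Suc k) * s ^ Suc k) (G (Suc k))
      + scale s (scale ((n gchoose k) * s ^ k) (G (Suc k)))" for k
  proof -
    have "(n + 1 gchoose Suc k) * s ^ Suc k = (n gchoose Suc k) * s ^ Suc k + s * ((n gchoose k) * s ^ k)"
      by (simp only: gbinomial_Suc_Suc) (simp add: algebra_simps)
    then show ?thesis by (simp only: scale_left_distrib scale_scale)
  qed
  then show ?thesis
    unfolding sum.lessThan_Suc_shift by (simp add: sum.distrib scale_sum_right del: power_Suc)
qed

text \<open>In the notation of \<open>delta_product\<close>: multiplying the delta series by y is the same as multiplying
  it by t + s z, which is Pascal's rule. The hypothesis keeps the sums finite: either
  \<open>(t + s z)^(-p-1)\<close> is a polynomial or X is bounded below in z.\<close>
lemma delta_product_pascal: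
  assumes fin: "p < 0 \<or> (\<forall>q<N. \<forall>r. X q r = 0)"
  shows "delta_product scale s X (p - 1) q r =
    delta_product scale s X p q (r - 1) + scale s (delta_product scale s X p (q - 1) r)"
proof -
  \<comment> \<open>The two summands are the bounds coming from the two alternatives for finiteness.\<close>
  define M where "M = nat (- p) + nat (q - N + 1)"
  let ?n = "of_int (- p - 1) :: complex"
  let ?G = "\<lambda>k. X (q - int k) (r + p + int k)"
  have lhs: "delta_product scale s X (p - 1) q r =
      (\<Sum>k<Suc M. scale ((?n + 1 gchoose k) * s ^ k) (?G k))"
    using fin by (subst delta_product_eq_sum[where M = "Suc M"])
      (auto simp: M_def gchoose_of_int_eq_0 simp del: of_int_minus)
  have rhs1: "delta_product scale s X p q (r - 1) =
      (\<Sum>k<Suc M. scale ((?n gchoose k) * s ^ k) (?G k))"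
    by (subst delta_product_eq_sum[where M = "Suc M"])
       (use fin in \<open>auto simp: M_def gchoose_of_int_eq_0 simp del: of_int_diff of_int_minus\<close>)
  have rhs2: "delta_product scale s X p (q - 1) r =
      (\<Sum>k<M. scale ((?n gchoose k) * s ^ k) (?G (Suc k)))"
    by (subst delta_product_eq_sum[where M = M])
       (use fin in \<open>auto simp: M_def gchoose_of_int_eq_0 algebra_simps simp del: of_int_diff of_int_minus\<close>)
  show ?thesis
    unfolding lhs rhs1 rhs2 by (rule Pascal_sum)
qed

lemma delta_product_residue: "delta_product scale s X (-1) q r = X q r"
  by (subst delta_product_eq_sum[where M = 1]) (auto simp: gbinomial_0_left)

lemma delta_product_eq_0:
  assumes "\<And>q r. q < N \<Longrightarrow> X q r = 0" and "q < N"
  shows "delta_product scale s X p q r = 0"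
proof -
  have "X (q - int k) r = 0" for k r
    using assms by simp
  then show ?thesis by (simp add: delta_product_def)
qed

lemma delta_product_flip_sign:
  "delta_product scale (-1) (\<lambda>q r. scale ((-1) powi q) (X q r)) p q r =
   scale ((-1) powi q) (delta_product scale 1 X p q r)"
proof -
  have sign: "z * (-1) ^ k * (-1) powi (q - int k) = ((-1) powi q :: complex) * z" for z k
    by (simp add: power_int_diff)
  show ?thesis
    by (simp add: delta_product_def sign flip: Sum_any_scale)
qed

text \<open>The left side is the coefficient of \<open>x0^a x1^b\<close> in \<open>(x1 - x0)^m\<close> times the part of E with
  exponent c of x2, because the coefficient of \<open>x2^(-1-m)\<close> in \<open>x2^-1 delta((x1 - x0)/x2)\<close> is
  \<open>(x1 - x0)^m\<close>. On solutions E, the factor x1 - x0 acts as x2.\<close>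
lemma delta_equation_multiply:
  assumes "delta_equation E"
  shows "delta_product scale (-1) (\<lambda>a b. E a b c) (- 1 - int m) a b = E a b (c - int m)"
proof (induction m arbitrary: a b)
  case 0
  then show ?case by (simp add: delta_product_residue)
next
  case (Suc m)
  have "delta_product scale (-1) (\<lambda>a b. E a b c) (- 1 - int (Suc m)) a b =
      E a (b - 1) (c - int m) - E (a - 1) b (c - int m)"
    using delta_product_pascal[of "- 1 - int m" _ "\<lambda>a b. E a b c" "-1" a b]
    by (simp add: Suc algebra_simps)
  also have "\<dots> = E a b (c - int m - 1)"
    using assms by (simp add: delta_equation_def)
  finally show ?case by (simp add: algebra_simps)
qed

section \<open>Coefficients of the series in the axioms\<close>

lemma series_mult3_left:
  "series_mult3 scale (\<lambda>a b c. delta_quotient 1 (-1) b c a)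
     (\<lambda>a b c. if a = 0 then P b c else 0) a b c
   = delta_product scale (-1) (\<lambda>c b. P b c) a c b"
proof -
  have "series_mult3 scale (\<lambda>a b c. delta_quotient 1 (-1) b c a)
      (\<lambda>a b c. if a = 0 then P b c else 0) a b c =
    Sum_any (\<lambda>k. case (a, - a - 1 - int k, int k) of (i, j, k) \<Rightarrow>
      scale (delta_quotient 1 (-1) j k i) (if a - i = 0 then P (b - j) (c - k) else 0))"
    unfolding series_mult3_def
    by (rule Sum_any_reindex_inj[where h = "\<lambda>(i, j, k). nat k"])
       (auto simp: inj_def delta_quotient_def binom_expansion_def split: if_splits)
  then show ?thesis
    by (simp add: delta_product_def delta_quotient_def formal_delta_def binom_expansion_def
        algebra_simps)
qed

text \<open>The delta series here is \<open>x0^-1 delta((-x2 + x1)/x0)\<close>; pulling the sign out of -x2 + x1 leaves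
  x2 - x1, expanded in nonnegative powers of x1, and the sign \<open>(-1)^(-a-1)\<close>.\<close>
lemma series_mult3_right:
  "series_mult3 scale (\<lambda>a b c. delta_quotient (-1) 1 c b a)
     (\<lambda>a b c. if a = 0 then P b c else 0) a b c
   = scale ((-1) powi (a + 1)) (delta_product scale (-1) P a b c)"
proof -
  have sign: "z * (-1) powi (- a - 1 - int k) = (-1) powi (a + 1) * (z * (-1) ^ k :: complex)"
    for z k
    by (simp add: power_int_minus_left minus_one_power_iff)
  have "series_mult3 scale (\<lambda>a b c. delta_quotient (-1) 1 c b a)
      (\<lambda>a b c. if a = 0 then P b c else 0) a b c =
    Sum_any (\<lambda>k. case (a, int k, - a - 1 - int k) of (i, j, k) \<Rightarrow>
      scale (delta_quotient (-1) 1 k j i) (if a - i = 0 then P (b - j) (c - k) else 0))"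
    unfolding series_mult3_def
    by (rule Sum_any_reindex_inj[where h = "\<lambda>(i, j, k). nat j"])
       (auto simp: inj_def delta_quotient_def binom_expansion_def split: if_splits)
  also have "\<dots> = Sum_any (\<lambda>k. scale ((-1) powi (a + 1))
      (scale ((of_int (- a - 1) gchoose k) * (-1) ^ k) (P (b - int k) (c + a + 1 + int k))))"
    by (rule Sum_any.cong)
       (simp add: delta_quotient_def formal_delta_def binom_expansion_def sign,
        simp add: algebra_simps)
  also have "\<dots> = scale ((-1) powi (a + 1)) (delta_product scale (-1) P a b c)"
    by (simp add: delta_product_def flip: Sum_any_scale)
  finally show ?thesis .
qed

lemma series_mult3_iterate:
  "series_mult3 scale (\<lambda>a b c. delta_quotient 1 1 c a b)
     (\<lambda>a b c. if b = 0 then P a c else 0) a b c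
   = delta_product scale 1 P b a c"
proof -
  have "series_mult3 scale (\<lambda>a b c. delta_quotient 1 1 c a b)
      (\<lambda>a b c. if b = 0 then P a c else 0) a b c =
    Sum_any (\<lambda>k. case (int k, b, - b - 1 - int k) of (i, j, k) \<Rightarrow>
      scale (delta_quotient 1 1 k i j) (if b - j = 0 then P (a - i) (c - k) else 0))"
    unfolding series_mult3_def
    by (rule Sum_any_reindex_inj[where h = "\<lambda>(i, j, k). nat i"])
       (auto simp: inj_def delta_quotient_def binom_expansion_def split: if_splits)
  then show ?thesis
    by (simp add: delta_product_def delta_quotient_def formal_delta_def binom_expansion_def
        algebra_simps)
qed

lemma series_mult2_power:
  "series_mult2 scale (\<lambda>a b. binom_expansion 1 (-1) (int m) b a) F a b
   = delta_product scale (-1) F (- 1 - int m) a b"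
proof -
  have "series_mult2 scale (\<lambda>a b. binom_expansion 1 (-1) (int m) b a) F a b =
    Sum_any (\<lambda>k. case (int k, int m - int k) of (i, j) \<Rightarrow>
      scale (binom_expansion 1 (-1) (int m) j i) (F (a - i) (b - j)))"
    unfolding series_mult2_def
    by (rule Sum_any_reindex_inj[where h = "\<lambda>(i, j). nat i"])
       (auto simp: inj_def binom_expansion_def split: if_splits)
  then show ?thesis
    by (simp add: delta_product_def binom_expansion_def algebra_simps)
qed

text \<open>A substitution is a residue of a product with a delta series, the exponent -1 being that of the
  substituted variable. The sign of \<open>\<beta>\<close> changes because the binomial coefficient of i + k over k is,
  up to the sign \<open>(-1)^k\<close>, that of -i-1 over k.\<close>
lemma series_subst_eq_delta_product:
  assumes "\<alpha> \<noteq> 0"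
  shows "series_subst scale \<alpha> \<beta> F i j
    = scale (\<alpha> powi i) (delta_product scale (- \<beta>) (\<lambda>q n. F n q) i j (-1))"
proof -
  have "series_subst scale \<alpha> \<beta> F i j =
    Sum_any (\<lambda>k. case (i + int k, j - int k) of (n, q) \<Rightarrow>
      scale (binom_expansion \<alpha> \<beta> n i (j - q)) (F n q))"
    unfolding series_subst_def
    by (rule Sum_any_reindex_inj[where h = "\<lambda>(n, q). nat (j - q)"])
       (auto simp: inj_def binom_expansion_def split: if_splits)
  also have "\<dots> = Sum_any (\<lambda>k. scale (\<alpha> powi i)
      (scale ((of_int (- i - 1) gchoose k) * (- \<beta>) ^ k) (F (i + int k) (j - int k))))"
  proof (rule Sum_any.cong)
    fix k
    have "((of_int (i + int k) :: complex) gchoose k) = (-1) ^ k * (of_int (- i - 1) gchoose k)"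
      by (subst gbinomial_negated_upper) simp
    then show "(case (i + int k, j - int k) of (n, q) \<Rightarrow>
        scale (binom_expansion \<alpha> \<beta> n i (j - q)) (F n q)) =
      scale (\<alpha> powi i)
        (scale ((of_int (- i - 1) gchoose k) * (- \<beta>) ^ k) (F (i + int k) (j - int k)))"
      by (simp add: binom_expansion_def power_minus[of \<beta>] mult_ac)
  qed
  also have "\<dots> = scale (\<alpha> powi i) (delta_product scale (- \<beta>) (\<lambda>q n. F n q) i j (-1))"
    using assms by (simp add: delta_product_def add_ac flip: Sum_any_scale)
  finally show ?thesis .
qed

section \<open>The three terms of the Jacobi identity\<close>

definition left_term :: "(int \<Rightarrow> int \<Rightarrow> 'w) \<Rightarrow> int \<Rightarrow> int \<Rightarrow> int \<Rightarrow> 'w" where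
  "left_term P a b c = delta_product scale (-1) (\<lambda>c b. P b c) a c b"

definition right_term :: "(int \<Rightarrow> int \<Rightarrow> 'w) \<Rightarrow> int \<Rightarrow> int \<Rightarrow> int \<Rightarrow> 'w" where
  "right_term P a b c = scale ((-1) powi (a + 1)) (delta_product scale (-1) P a b c)"

definition iterate_term :: "(int \<Rightarrow> int \<Rightarrow> 'w) \<Rightarrow> int \<Rightarrow> int \<Rightarrow> int \<Rightarrow> 'w" where
  "iterate_term P a b c = delta_product scale 1 P b a c"

lemma right_term_transpose:
  "right_term P a b c = scale ((-1) powi (a + 1)) (left_term (\<lambda>b c. P c b) a c b)"
  by (simp add: right_term_def left_term_def)

lemma delta_equation_left_term:
  assumes "\<And>b c. c < N \<Longrightarrow> P b c = 0"
  shows "delta_equation (left_term P)"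
  unfolding delta_equation_def left_term_def
  using assms by (auto simp: delta_product_pascal[where N = N])

lemma delta_equation_right_term:
  assumes "\<And>b c. b < N \<Longrightarrow> P b c = 0"
  shows "delta_equation (right_term P)"
  unfolding delta_equation_def right_term_def
  using assms by (auto simp: delta_product_pascal[where N = N] power_int_minus_left scale_right_diff_distrib)

lemma delta_equation_iterate_term:
  assumes "\<And>a c. a < N \<Longrightarrow> P a c = 0"
  shows "delta_equation (iterate_term P)"
  unfolding delta_equation_def iterate_term_def
  using assms by (auto simp: delta_product_pascal[where N = N])

lemma iterate_term_residue: "iterate_term P a (-1) c = P a c"
  by (simp add: iterate_term_def delta_product_residue)

end

section \<open>The axioms as conditions on the three terms\<close>

locale vertex_operator_pair =
  algebra: vertex_operator_map scaleV scaleV Y + action: vertex_operator_map scaleV scaleW YW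
  for scaleV :: "complex \<Rightarrow> 'v::ab_group_add \<Rightarrow> 'v"
    and scaleW :: "complex \<Rightarrow> 'w::ab_group_add \<Rightarrow> 'w"
    and Y :: "'v \<Rightarrow> int \<Rightarrow> 'v \<Rightarrow> 'v"
    and YW :: "'v \<Rightarrow> int \<Rightarrow> 'w \<Rightarrow> 'w"
begin

sublocale complex_space scaleW
  using action.linear_operator by (simp add: complex_space_def Vector_Spaces.linear_def)

lemma YW_zero [simp]: "YW v k 0 = 0" "YW 0 k w = 0"
  using module_hom.zero[OF module_hom_iff_linear[THEN iffD2, OF action.linear_operator]]
    module_hom.zero[OF module_hom_iff_linear[THEN iffD2, OF action.linear_map]] by auto

lemma YW_scale: "YW (scaleV c v) k w = scaleW c (YW v k w)"
  by (rule module_hom.scale[OF module_hom_iff_linear[THEN iffD2, OF action.linear_map]])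

abbreviation left_product where
  "left_product u v w \<equiv> left_term (\<lambda>b c. YW u b (YW v c w))"

abbreviation right_product where
  "right_product u v w \<equiv> right_term (\<lambda>b c. YW v c (YW u b w))"

abbreviation iterate where
  "iterate u v w \<equiv> iterate_term (\<lambda>a c. YW (Y u a v) c w)"

lemma jacobi_identity_iff:
  "jacobi_identity scaleW Y YW u v w \<longleftrightarrow>
   (\<forall>a b c. left_product u v w a b c - right_product u v w a b c = iterate u v w a b c)"
  unfolding jacobi_identity_def series_mult3_left series_mult3_right series_mult3_iterate
  by (simp add: left_term_def right_term_def iterate_term_def)

text \<open>The exchange of u with v, x1 with x2 and x0 with -x0 takes the left product to minus
  the right product.\<close>
lemma right_product_eq:
  "right_product u v w a b c = scaleW ((-1) powi (a + 1)) (left_product v u w a c b)"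
  by (rule right_term_transpose)

lemma truncated_below: "\<exists>N. \<forall>k<N. YW v k w = 0"
  using action.truncation unfolding lower_truncated_def by blast

lemma delta_equation_left_product: "delta_equation (left_product u v w)"
proof -
  obtain N where "\<And>k. k < N \<Longrightarrow> YW v k w = 0" using truncated_below by blast
  then show ?thesis by (intro delta_equation_left_term[of N]) simp
qed

lemma delta_equation_right_product: "delta_equation (right_product u v w)"
proof -
  obtain N where "\<And>k. k < N \<Longrightarrow> YW u k w = 0" using truncated_below by blast
  then show ?thesis by (intro delta_equation_right_term[of N]) simp
qed

lemma delta_equation_iterate: "delta_equation (iterate u v w)"
proof -
  obtain N where "\<forall>k<N. Y u k v = 0"
    using algebra.truncation unfolding lower_truncated_def by blast
  then show ?thesis
    by (intro delta_equation_iterate_term[of N]) simp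
qed

lemma left_product_truncated:
  obtains N where "\<And>a b c. c < N \<Longrightarrow> left_product u v w a b c = 0"
proof -
  obtain N where "\<And>k. k < N \<Longrightarrow> YW v k w = 0" using truncated_below by blast
  then show thesis
    by (intro that[of N]) (simp add: left_term_def delta_product_eq_0[where N = N])
qed

text \<open>Taking residues in x2 gives Y_W(v,-x0+x1)Y_W(u,x1)w from minus the right product and
  Y_W(Y(u,x0)v,x1-x0)w from the iterate. The factor \<open>(x1 - x0)^m\<close> shifts the exponent of x2 by
  m, and vanishing at one exponent of x2 propagates to all lower ones.\<close>
lemma weak_skew_associativity_iff:
  "weak_skew_associativity scaleW Y YW u v w \<longleftrightarrow>
   (\<exists>N. \<forall>a b c. c < N \<longrightarrow> right_product u v w a b c + iterate u v w a b c = 0)"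
proof -
  define E where "E = (\<lambda>a b c. - right_product u v w a b c - iterate u v w a b c)"
  have E: "delta_equation E"
    unfolding E_def
    by (intro delta_equation_diff delta_equation_minus delta_equation_right_product
        delta_equation_iterate)
  have residue: "series_subst scaleW (-1) 1 (\<lambda>n q. YW v n (YW u q w)) a b
      - series_subst scaleW 1 (-1) (\<lambda>n q. YW (Y u q v) n w) b a = E a b (-1)" for a b
  proof -
    have "(-1) powi (a + 1) = (- ((-1) powi a) :: complex)"
      by (simp add: power_int_add)
    then show ?thesis
      by (simp add: E_def series_subst_eq_delta_product right_term_def iterate_term_def)
  qed
  have E_eq_0_iff: "E a b c = 0 \<longleftrightarrow> right_product u v w a b c + iterate u v w a b c = 0" for a b c
  proof -
    have "E a b c = - (right_product u v w a b c + iterate u v w a b c)"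
      by (simp add: E_def)
    then show ?thesis by (simp only: neg_equal_0_iff_equal)
  qed
  have "weak_skew_associativity scaleW Y YW u v w \<longleftrightarrow> (\<exists>m. \<forall>a b. E a b (-1 - int m) = 0)"
    unfolding weak_skew_associativity_def residue series_mult2_power
      delta_equation_multiply[OF E] ..
  also have "\<dots> \<longleftrightarrow> (\<exists>N. \<forall>a b c. c < N \<longrightarrow> E a b c = 0)"
    by (rule delta_equation_vanishes_below_iff[OF E])
  finally show ?thesis
    unfolding E_eq_0_iff .
qed

text \<open>The axiom is the case b = -1, the residue in x1; rigidity of the delta equation
  extends it to all lower exponents of x1.\<close>
lemma vacuum_free_skew_symmetry_iff:
  "vacuum_free_skew_symmetry scaleV scaleW Y YW u v \<longleftrightarrow>
   (\<forall>w a b c. b < 0 \<longrightarrow> iterate u v w a b c = scaleW ((-1) powi a) (iterate v u w a c b))"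
proof -
  have "vacuum_free_skew_symmetry scaleV scaleW Y YW u v \<longleftrightarrow>
    (\<forall>w a c. iterate u v w a (-1) c = scaleW ((-1) powi a) (iterate v u w a c (-1)))"
    by (simp add: vacuum_free_skew_symmetry_def series_subst_eq_delta_product YW_scale
        delta_product_flip_sign iterate_term_residue) (simp add: iterate_term_def)
  also have "\<dots> \<longleftrightarrow>
    (\<forall>w a b c. b < 0 \<longrightarrow> iterate u v w a b c = scaleW ((-1) powi a) (iterate v u w a c b))"
    (is "?residue \<longleftrightarrow> ?below")
  proof
    assume residue: ?residue
    show ?below
    proof (intro allI impI)
      fix w a b c
      assume "(b::int) < 0"
      then have "b \<le> -1" by linarith
      show "iterate u v w a b c = scaleW ((-1) powi a) (iterate v u w a c b)"
        by (rule delta_equation_eq_below[OF delta_equation_iterate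
              delta_equation_swap[OF delta_equation_iterate] _ \<open>b \<le> -1\<close>])
           (rule residue[rule_format])
    qed
  next
    assume below: ?below
    show ?residue
      by (intro allI below[rule_format]) simp
  qed
  finally show ?thesis .
qed

section \<open>Comparison with the Jacobi identity\<close>

lemma weak_skew_associativity_of_jacobi:
  assumes "jacobi_identity scaleW Y YW u v w"
  shows "weak_skew_associativity scaleW Y YW u v w"
proof -
  have "right_product u v w a b c + iterate u v w a b c = left_product u v w a b c" for a b c
    using assms unfolding jacobi_identity_iff by (metis add.commute diff_add_cancel)
  then show ?thesis
    unfolding weak_skew_associativity_iff by (metis left_product_truncated[of u v w])
qed

text \<open>The difference of left and right product is invariant under the exchange of u and v.\<close>
lemma vacuum_free_skew_symmetry_of_jacobi:
  assumes "\<And>w. jacobi_identity scaleW Y YW u v w" and "\<And>w. jacobi_identity scaleW Y YW v u w"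
  shows "vacuum_free_skew_symmetry scaleV scaleW Y YW u v"
  unfolding vacuum_free_skew_symmetry_iff
proof (intro allI impI)
  fix w a b c
  have "iterate u v w a b c = left_product u v w a b c - right_product u v w a b c"
    using assms(1) by (simp add: jacobi_identity_iff)
  also have "\<dots> = scaleW ((-1) powi a) (left_product v u w a c b - right_product v u w a c b)"
    unfolding right_product_eq by (simp add: power_int_minus_left)
  also have "\<dots> = scaleW ((-1) powi a) (iterate v u w a c b)"
    using assms(2) by (simp add: jacobi_identity_iff)
  finally show "iterate u v w a b c = scaleW ((-1) powi a) (iterate v u w a c b)" .
qed

text \<open>The defect of the Jacobi identity solves the delta equation, so it suffices that it vanishes
  in low powers of x1 and in low powers of x2. Weak skew-associativity for u, v gives the second, and
  for v, u, through skew-symmetry, the first.\<close>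
lemma jacobi_of_weak_skew_associativity:
  assumes uv: "weak_skew_associativity scaleW Y YW u v w"
    and vu: "weak_skew_associativity scaleW Y YW v u w"
    and skew: "vacuum_free_skew_symmetry scaleV scaleW Y YW u v"
  shows "jacobi_identity scaleW Y YW u v w"
proof -
  let ?E = "\<lambda>a b c. left_product u v w a b c - right_product u v w a b c - iterate u v w a b c"
  have E: "delta_equation ?E"
    by (intro delta_equation_diff delta_equation_left_product delta_equation_right_product
        delta_equation_iterate)
  obtain M1 where M1: "\<And>a b c. c < M1 \<Longrightarrow> left_product u v w a b c = 0"
    using left_product_truncated by blast
  obtain M2 where M2: "\<And>a b c. c < M2 \<Longrightarrow> right_product u v w a b c + iterate u v w a b c = 0"
    using uv unfolding weak_skew_associativity_iff by blast
  have c: "?E a b c = 0" if "c \<le> min M1 M2 - 1" for a b c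
    unfolding diff_diff_eq using that by (simp add: M1 M2)
  obtain N1 where N1: "\<And>a b c. c < N1 \<Longrightarrow> left_product v u w a b c = 0"
    using left_product_truncated by blast
  obtain N2 where N2: "\<And>a b c. c < N2 \<Longrightarrow> right_product v u w a b c + iterate v u w a b c = 0"
    using vu unfolding weak_skew_associativity_iff by blast
  \<comment> \<open>The bound 0 is where skew-symmetry stops relating the iterates.\<close>
  have b: "?E a b c = 0" if "b \<le> min 0 (min N1 N2) - 1" for a b c
  proof -
    have "right_product u v w a b c = 0"
      using that by (simp add: right_product_eq N1)
    moreover have "iterate u v w a b c = scaleW ((-1) powi a) (iterate v u w a c b)"
      using skew that by (simp add: vacuum_free_skew_symmetry_iff)
    moreover have "iterate v u w a c b = - right_product v u w a c b"
      using N2[of b a c] that by (simp add: add_eq_0_iff)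
    moreover have "right_product v u w a c b = scaleW ((-1) powi (a + 1)) (left_product u v w a b c)"
      by (rule right_product_eq)
    ultimately show ?thesis
      by (simp add: power_int_minus_left split: if_splits)
  qed
  have "?E a b c = 0" for a b c
    by (rule delta_equation_quadrant_zero[OF E b c])
  then show ?thesis by (simp add: jacobi_identity_iff)
qed

end

theorem proposition5p5:
  fixes scaleV :: "complex \<Rightarrow> 'v::ab_group_add \<Rightarrow> 'v"
    and scaleW :: "complex \<Rightarrow> 'w::ab_group_add \<Rightarrow> 'w"
    and Y :: "'v \<Rightarrow> int \<Rightarrow> 'v \<Rightarrow> 'v"
    and YW :: "'v \<Rightarrow> int \<Rightarrow> 'w \<Rightarrow> 'w"
  assumes "vacuum_free_vertex_algebra scaleV Y"
    and "vertex_operator_map scaleV scaleW YW"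
  shows "(\<forall>u v w. jacobi_identity scaleW Y YW u v w) \<longleftrightarrow>
    (\<forall>u v w. weak_skew_associativity scaleW Y YW u v w) \<and>
    (\<forall>u v. vacuum_free_skew_symmetry scaleV scaleW Y YW u v)"
proof -
  interpret vertex_operator_pair scaleV scaleW Y YW
    using assms by (simp add: vertex_operator_pair_def vacuum_free_vertex_algebra_def)
  show ?thesis
    using weak_skew_associativity_of_jacobi vacuum_free_skew_symmetry_of_jacobi
      jacobi_of_weak_skew_associativity by blast
qed

end
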